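(* Let $(\theta_i)_{i\ge 1}$ be i.i.d. random vectors with law $\sigma$ on $\mathbb{S}^{d-1}$, and for $p\ge 1$ let $\mathcal{E}_p$ be built from $\theta_1,\dots,\theta_p$. Let $\mathcal{K}\subset\mathbb{R}^{n\times d}$ be compact. Then $$\mathbb{P}\Big(\|\mathcal{E}_p-\mathcal{E}\|_{\ell^\infty(\mathcal{K})}\xrightarrow[p\to+\infty]{}0\Big)=1,$$ where $\|f\|_{\ell^\infty(\mathcal{K})}:=\sup_{x\in\mathcal{K}}|f(x)|$ for $f$ continuous on $\mathcal{K}$.
   Context: Let $n,d\ge1$. A matrix $Y\in\mathbb{R}^{n\times d}$ is written $Y=(y_1,\dots,y_n)^T$ with rows $y_k\in\mathbb{R}^d$, and $\gamma_Y:=\frac1n\sum_{k=1}^n\delta_{y_k}$. Fix $Z\in\mathbb{R}^{n\times d}$. $\sigma$ denotes the uniform probability measure on the unit sphere $\mathbb{S}^{d-1}$ of $\mathbb{R}^d$, $P_\theta(x)=\theta^Tx$, $\#$ is push-forward, and $\mathrm{W}_2$ is the 2-Wasserstein distance. Define $w_\theta(Y):=\mathrm{W}_2^2(P_\theta\#\gamma_Y,P_\theta\#\gamma_Z)$, $\mathcal{E}(Y):=\int_{\mathbb{S}^{d-1}}w_\theta(Y)\,d\sigma(\theta)$, and, for directions $\theta_1,\dots,\theta_p\in\mathbb{S}^{d-1}$, $\mathcal{E}_p(Y):=\frac1p\sum_{i=1}^p w_{\theta_i}(Y)$. *)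

theory Defs
  imports "HOL-Probability.Probability"
begin

text \<open>
  The measure \<open>(1/n) \<Sum>\<^sub>k \<delta>\<^bsub>y\<^sub>k\<^esub>\<close> carried by the rows of a matrix; \<open>return borel y\<close> is the Dirac
  measure at \<open>y\<close>.
\<close>

definition empirical_measure :: "real ^ 'd ^ 'n \<Rightarrow> (real ^ 'd) measure" where
  "empirical_measure Y = measure_of UNIV (sets borel)
     (\<lambda>A. ennreal (1 / real CARD('n)) * (\<Sum>k\<in>UNIV. emeasure (return borel (Y $ k)) A))"

lemma sets_empirical_measure [simp, measurable_cong]: "sets (empirical_measure Y) = sets borel"
  by (simp add: empirical_measure_def sets.sigma_sets_eq[of borel, simplified])

lemma space_empirical_measure [simp]: "space (empirical_measure Y) = UNIV"
  by (simp add: empirical_measure_def)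

text \<open>
  The set function handed to \<open>measure_of\<close> is a measure, so \<open>measure_of\<close> does not collapse to zero.
\<close>

lemma emeasure_empirical_measure:
  fixes Y :: "real ^ 'd ^ 'n"
  assumes "A \<in> sets borel"
  shows "emeasure (empirical_measure Y) A
    = ennreal (1 / real CARD('n)) * (\<Sum>k\<in>UNIV. emeasure (return borel (Y $ k)) A)"
proof (rule emeasure_measure_of[OF empirical_measure_def])
  let ?m = "\<lambda>A. ennreal (1 / real CARD('n)) * (\<Sum>k\<in>UNIV. emeasure (return borel (Y $ k)) A)"
  show "positive (sets (empirical_measure Y)) ?m"
    by (simp add: positive_def)
  show "countably_additive (sets (empirical_measure Y)) ?m"
  proof (rule countably_additiveI)
    fix B :: "nat \<Rightarrow> (real ^ 'd) set"
    assume B: "range B \<subseteq> sets (empirical_measure Y)" "disjoint_family B"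
    have "(\<Sum>i. ?m (B i)) = ennreal (1 / real CARD('n))
        * (\<Sum>k\<in>UNIV. \<Sum>i. emeasure (return borel (Y $ k)) (B i))"
      by (simp add: suminf_sum summableI)
    also have "\<dots> = ?m (\<Union>i. B i)"
      using B by (subst suminf_emeasure) auto
    finally show "(\<Sum>i. ?m (B i)) = ?m (\<Union>i. B i)" .
  qed
qed (use assms in auto)

lemma prob_space_empirical_measure: "prob_space (empirical_measure (Y :: real ^ 'd ^ 'n))"
proof
  show "emeasure (empirical_measure Y) (space (empirical_measure Y)) = 1"
    by (simp add: emeasure_empirical_measure ennreal_of_nat_eq_real_of_nat
        flip: ennreal_mult')
qed

definition couplings :: "'a measure \<Rightarrow> 'b measure \<Rightarrow> ('a \<times> 'b) measure set" where
  "couplings \<mu> \<nu> =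
     {\<pi>. sets \<pi> = sets (\<mu> \<Otimes>\<^sub>M \<nu>) \<and> distr \<pi> \<mu> fst = \<mu> \<and> distr \<pi> \<nu> snd = \<nu>}"

text \<open>
  The infimum is taken in \<open>[0, \<infinity>]\<close>; the final \<open>enn2real\<close> is harmless when both measures have
  finite second moment, which includes all finitely supported ones.
\<close>

definition wasserstein2 :: "'a::polish_space measure \<Rightarrow> 'a measure \<Rightarrow> real" where
  "wasserstein2 \<mu> \<nu> =
     sqrt (enn2real (INF \<pi>\<in>couplings \<mu> \<nu>. \<integral>\<^sup>+ z. ennreal ((dist (fst z) (snd z))\<^sup>2) \<partial>\<pi>))"

text \<open>
  The uniform probability measure on the unit sphere, as a measure whose underlying space is the
  sphere: the law of \<open>x / |x|\<close> for \<open>x\<close> uniform in the unit ball. The value \<open>0\<close> at the Lebesgue-null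
  point \<open>x = 0\<close> is removed by the restriction.
\<close>

definition uniform_sphere :: "'a::euclidean_space measure" where
  "uniform_sphere = restrict_space
     (distr (uniform_measure lborel (cball 0 1)) borel (\<lambda>x. x /\<^sub>R norm x)) (sphere 0 1)"

lemma space_uniform_sphere [simp]: "space uniform_sphere = sphere 0 1"
  by (simp add: uniform_sphere_def space_restrict_space)

lemma sets_uniform_sphere [measurable_cong]:
  "sets uniform_sphere = sets (restrict_space borel (sphere 0 1))"
  by (simp add: uniform_sphere_def sets_restrict_space)

lemma emeasure_uniform_sphere:
  fixes A :: "'a::euclidean_space set"
  assumes "A \<in> sets borel" "A \<subseteq> sphere 0 1"
  shows "emeasure uniform_sphere A
    = emeasure lborel {x \<in> cball 0 1. x /\<^sub>R norm x \<in> A} / emeasure lborel (cball 0 1 :: 'a set)"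
proof -
  have [measurable]: "A \<in> sets borel" by fact
  have "emeasure uniform_sphere A
      = emeasure (uniform_measure lborel (cball 0 1)) {x. x /\<^sub>R norm x \<in> A}"
    unfolding uniform_sphere_def using assms
    by (subst emeasure_restrict_space) (auto simp: emeasure_distr vimage_def)
  also have "\<dots> = emeasure lborel (cball 0 1 \<inter> {x. x /\<^sub>R norm x \<in> A})
      / emeasure lborel (cball 0 1 :: 'a set)"
    by (rule emeasure_uniform_measure) measurable
  also have "cball 0 1 \<inter> {x. x /\<^sub>R norm x \<in> A} = {x \<in> cball 0 1. x /\<^sub>R norm x \<in> A}"
    by auto
  finally show ?thesis .
qed

lemma prob_space_uniform_sphere: "prob_space (uniform_sphere :: 'a::euclidean_space measure)"
proof
  let ?B = "cball 0 1 :: 'a set"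
  have fin: "emeasure lborel ?B \<noteq> \<infinity>"
    using emeasure_lborel_cball_finite[of "0::'a" 1] by simp
  have pos: "emeasure lborel ?B \<noteq> 0"
    by (simp add: emeasure_cball unit_ball_vol_pos less_imp_neq[symmetric])
  have "{x \<in> ?B. x /\<^sub>R norm x \<in> sphere 0 1} = ?B - {0}"
    by auto
  moreover have "emeasure lborel (?B - {0}) = emeasure lborel ?B"
    by (rule emeasure_Diff_null_set) auto
  ultimately show "emeasure (uniform_sphere :: 'a measure) (space uniform_sphere) = 1"
    using fin pos by (simp add: emeasure_uniform_sphere ennreal_divide_self top.not_eq_extremum)
qed

text \<open>
  The sort constraint on the index type comes from the library theorem that orthogonal
  transformations preserve Lebesgue measure.
\<close>

lemma uniform_sphere_orthogonal_invariant:
  fixes T :: "real ^ 'd::{finite,wellorder} \<Rightarrow> real ^ 'd::{finite,wellorder}"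
  assumes T: "orthogonal_transformation T"
  shows "distr uniform_sphere uniform_sphere T = uniform_sphere"
proof (rule measure_eqI)
  have lin: "linear T" using T by (rule orthogonal_transformation_linear)
  have nT: "norm (T x) = norm x" for x
    using T by (rule orthogonal_transformation_norm)
  have bT [measurable]: "T \<in> borel_measurable borel"
    by (intro borel_measurable_continuous_onI linear_continuous_on linear_linear[THEN iffD2] lin)
  have mT [measurable]: "T \<in> measurable uniform_sphere uniform_sphere"
    unfolding measurable_cong_sets[OF sets_uniform_sphere sets_uniform_sphere]
    by (rule measurable_restrict_space3) (auto simp: nT)
  fix A assume "A \<in> sets (distr uniform_sphere uniform_sphere T)"
  then have A: "A \<in> sets uniform_sphere" by simp
  then have A': "A \<in> sets borel" "A \<subseteq> sphere 0 1"
    by (auto simp: sets_uniform_sphere sets_restrict_space_iff)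
  have [measurable]: "A \<in> sets borel" by fact
  define V where "V = {x \<in> cball 0 1. T x /\<^sub>R norm x \<in> A}"
  define W where "W = {x \<in> cball 0 1. x /\<^sub>R norm x \<in> A}"
  have [measurable]: "V \<in> sets borel" "W \<in> sets borel"
    unfolding V_def W_def by measurable
  have W: "W = T ` V"
  proof (intro subset_antisym subsetI)
    fix x assume "x \<in> W"
    moreover obtain y where "x = T y"
      using orthogonal_transformation_surj[OF T] by (metis surjD)
    ultimately show "x \<in> T ` V" by (auto simp: V_def W_def nT)
  qed (auto simp: V_def W_def nT)
  have "bounded V"
    by (rule bounded_subset[OF bounded_cball[of 0 1]]) (auto simp: V_def)
  then have "V \<in> lmeasurable"
    by (rule bounded_set_imp_lmeasurable) simp
  then have m: "measure lebesgue W = measure lebesgue V"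
    unfolding W by (rule measure_orthogonal_image[OF T])
  have fin: "emeasure lborel S < \<infinity>" if "S \<subseteq> cball 0 1" for S :: "(real ^ 'd::{finite,wellorder}) set"
    by (rule emeasure_bounded_finite) (use that bounded_subset in blast)
  have e: "emeasure lborel W = emeasure lborel V"
    using m fin[of V] fin[of W]
    by (simp add: V_def W_def emeasure_eq_ennreal_measure measure_completion subset_eq)
  have "emeasure (distr uniform_sphere uniform_sphere T) A
      = emeasure uniform_sphere (T -` A \<inter> sphere 0 1)"
    using A by (simp add: emeasure_distr mT)
  also have "\<dots> = emeasure lborel V / emeasure lborel (cball 0 1 :: (real ^ 'd::{finite,wellorder}) set)"
  proof (subst emeasure_uniform_sphere)
    have "T -` A \<in> sets borel"
      using measurable_sets[OF bT A'(1)] by simp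
    then show "T -` A \<inter> sphere 0 1 \<in> sets borel" by auto
    have "{x \<in> cball 0 1. x /\<^sub>R norm x \<in> T -` A \<inter> sphere 0 1} = V"
      using A'(2) by (force simp: V_def linear_scale[OF lin] nT)
    then show "emeasure lborel {x \<in> cball 0 1. x /\<^sub>R norm x \<in> T -` A \<inter> sphere 0 1}
        / emeasure lborel (cball 0 1 :: (real ^ 'd::{finite,wellorder}) set)
      = emeasure lborel V / emeasure lborel (cball 0 1 :: (real ^ 'd::{finite,wellorder}) set)" by simp
  qed simp
  also have "\<dots> = emeasure uniform_sphere A"
    using A' e by (simp add: emeasure_uniform_sphere W_def)
  finally show "emeasure (distr uniform_sphere uniform_sphere T) A = emeasure uniform_sphere A" .
qed simp

definition proj_dir :: "real ^ 'd \<Rightarrow> real ^ 'd \<Rightarrow> real" where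
  "proj_dir \<theta> x = \<theta> \<bullet> x"

definition w_dir :: "real ^ 'd ^ 'n \<Rightarrow> real ^ 'd \<Rightarrow> real ^ 'd ^ 'n \<Rightarrow> real" where
  "w_dir Z \<theta> Y = (wasserstein2 (distr (empirical_measure Y) borel (proj_dir \<theta>))
                               (distr (empirical_measure Z) borel (proj_dir \<theta>)))\<^sup>2"

definition energy :: "real ^ 'd ^ 'n \<Rightarrow> real ^ 'd ^ 'n \<Rightarrow> real" where
  "energy Z Y = (\<integral>\<theta>. w_dir Z \<theta> Y \<partial>uniform_sphere)"

definition energy_mc :: "real ^ 'd ^ 'n \<Rightarrow> (nat \<Rightarrow> real ^ 'd) \<Rightarrow> nat \<Rightarrow> real ^ 'd ^ 'n \<Rightarrow> real" where
  "energy_mc Z \<theta> p Y = (1 / real p) * (\<Sum>i=1..p. w_dir Z (\<theta> i) Y)"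

text \<open>
  The supremum is taken in \<open>[0, \<infinity>]\<close>, so it is \<open>0\<close> on the empty set and \<open>\<infinity>\<close> for unbounded \<open>f\<close>.
\<close>

definition linf_norm_on :: "'a set \<Rightarrow> ('a \<Rightarrow> real) \<Rightarrow> ennreal" where
  "linf_norm_on K f = (SUP x\<in>K. ennreal \<bar>f x\<bar>)"

end

theory Submission
  imports Defs
begin

text \<open>
  Between two empirical measures on \<open>n\<close> atoms every coupling is induced by a coupling of the uniform
  distributions on the index sets, so \<open>w\<^sub>\<theta>(Y)\<close> is an infimum of quadratic costs over a set that depends
  neither on \<open>\<theta>\<close> nor on \<open>Y\<close>. Hence \<open>w\<^sub>\<theta>(Y)\<close> is bounded and Lipschitz in \<open>\<theta>\<close> and \<open>Y\<close>, uniformly on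
  bounded sets. For fixed \<open>Y\<close> Hoeffding's inequality and the Borel-Cantelli lemma give almost sure
  convergence; it holds simultaneously on a countable dense subset of the compact set and extends
  uniformly to the whole set by equi-Lipschitz continuity.
\<close>

section \<open>Optimal transport between empirical measures\<close>

text \<open>The only nontrivial condition in the type \<open>pmf\<close> is that almost every point
  has positive mass; here the points of mass zero form a finite union of null singletons.\<close>

lemma measure_pmf_of_finite_prob_space:
  fixes M :: "'a::finite measure"
  assumes "prob_space M" "sets M = UNIV"
  obtains p where "measure_pmf p = M"
proof -
  interpret prob_space M by fact
  have sp: "space M = UNIV" using assms(2) by (metis UNIV_I sets.sets_into_space top.extremum_uniqueI)
  let ?N = "{x. measure M {x} = 0}"
  have "emeasure M ?N = (\<Sum>x\<in>?N. emeasure M {x})"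
    by (rule emeasure_eq_sum_singleton) (auto simp: assms)
  also have "\<dots> = 0"
    by (simp add: emeasure_eq_measure)
  finally have "?N \<in> null_sets M"
    by (auto simp: assms)
  then have "AE x in M. measure M {x} \<noteq> 0"
    by (rule AE_I') (auto simp: sp)
  with assms have "M \<in> {M. prob_space M \<and> sets M = UNIV \<and> (AE x in M. measure M {x} \<noteq> 0)}"
    by blast
  then show thesis
    by (intro that[of "Abs_pmf M"]) (rule Abs_pmf_inverse)
qed

text \<open>When both index types have n elements, these are the doubly stochastic matrices scaled
  by 1/n. The encoding by \<open>pmf\<close> makes marginals, mixtures and expectations available
  directly.\<close>

definition uniform_couplings :: "('n::finite \<times> 'm::finite) pmf set" where
  "uniform_couplings = {p. map_pmf fst p = pmf_of_set UNIV \<and> map_pmf snd p = pmf_of_set UNIV}"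

lemma uniform_couplings_nonempty: "uniform_couplings \<noteq> {}"
proof -
  have "pair_pmf (pmf_of_set UNIV) (pmf_of_set UNIV) \<in> uniform_couplings"
    by (simp add: uniform_couplings_def map_fst_pair_pmf map_snd_pair_pmf)
  then show ?thesis by blast
qed

text \<open>An index \<open>i\<close> is reached from exactly the members of its own fibre, each
  contributing the reciprocal of the fibre's size. This restores uniform marginals when several
  indices share one atom.\<close>

lemma bind_pmf_of_set_fibre:
  fixes a :: "'n::finite \<Rightarrow> 'a"
  shows "bind_pmf (pmf_of_set UNIV) (\<lambda>k. pmf_of_set {j. a j = a k}) = pmf_of_set UNIV"
proof (rule pmf_eqI)
  fix i
  let ?F = "{j. a j = a i}"
  have ne: "{j. a j = a k} \<noteq> {}" for k by auto
  have "pmf (bind_pmf (pmf_of_set UNIV) (\<lambda>k. pmf_of_set {j. a j = a k})) i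
      = (\<Sum>k\<in>UNIV. indicator {j. a j = a k} i / real (card {j. a j = a k})) / real CARD('n)"
    by (simp add: pmf_bind integral_pmf_of_set pmf_of_set[OF ne])
  also have "(\<Sum>k\<in>UNIV. indicator {j. a j = a k} i / real (card {j. a j = a k}))
      = (\<Sum>k\<in>?F. 1 / real (card ?F))"
    by (rule sum.mono_neutral_cong_right) (auto simp: indicator_def)
  also have "\<dots> = 1"
    using ne[of i] by simp
  finally show "pmf (bind_pmf (pmf_of_set UNIV) (\<lambda>k. pmf_of_set {j. a j = a k})) i
      = pmf (pmf_of_set UNIV) i" by simp
qed

lemma measurable_fibre_choice:
  fixes a :: "'n::finite \<Rightarrow> 'a::t1_space"
  shows "(\<lambda>x. SOME k. a k = x) \<in> measurable borel (count_space UNIV)"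
proof (rule measurable_count_space_eq2[THEN iffD2], simp, safe)
  fix i :: 'n
  let ?r = "\<lambda>x. SOME k. a k = x"
  \<comment> \<open>Off the finite range of \<open>a\<close> the choice is one fixed unspecified
    index. Each preimage is therefore a finite, hence closed, set, possibly joined with the
    complement of the range.\<close>
  have r: "?r x = (SOME k. False)" if "x \<notin> range a" for x
    using that by (intro arg_cong[where f = Eps]) auto
  have fin: "S \<in> sets borel" if "S \<subseteq> range a" for S
    by (rule borel_closed, rule finite_imp_closed, rule finite_subset[OF that]) simp
  have "?r -` {i} = (?r -` {i} \<inter> range a) \<union> (if (SOME k. False) = i then - range a else {})"
    using r by (auto simp del: split_paired_All) metis+
  also have "\<dots> \<in> sets borel"
    using fin by (intro sets.Un) (auto intro!: borel_comp)
  finally show "?r -` {i} \<inter> space borel \<in> sets borel" by simp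
qed auto

text \<open>Choose an index for each atom, then spread its mass uniformly over the fibre of the atom.\<close>

lemma coupling_imp_uniform_coupling:
  fixes a :: "'n::finite \<Rightarrow> 'a::polish_space" and b :: "'m::finite \<Rightarrow> 'a"
  assumes \<pi>: "\<pi> \<in> couplings (distr (pmf_of_set UNIV) borel a) (distr (pmf_of_set UNIV) borel b)"
    and f: "f \<in> borel_measurable (borel \<Otimes>\<^sub>M borel)"
  obtains p where "p \<in> uniform_couplings"
    and "(\<integral>\<^sup>+ z. f z \<partial>\<pi>) = (\<integral>\<^sup>+ z. f (a (fst z), b (snd z)) \<partial>p)"
proof -
  define r where "r x = (SOME k. a k = x)" for x
  define s where "s x = (SOME k. b k = x)" for x
  have r [measurable]: "r \<in> measurable borel (count_space UNIV)"
    and s [measurable]: "s \<in> measurable borel (count_space UNIV)"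
    unfolding r_def s_def by (rule measurable_fibre_choice)+
  have ar: "a (r (a k)) = a k" for k unfolding r_def by (rule someI) (rule refl)
  have bs: "b (s (b k)) = b k" for k unfolding s_def by (rule someI) (rule refl)
  have sets_\<pi> [measurable_cong]: "sets \<pi> = sets (borel \<Otimes>\<^sub>M borel)"
    using \<pi> unfolding couplings_def
    by (simp add: sets_pair_measure_cong[OF sets_distr sets_distr])
  have fst_\<pi>: "distr \<pi> borel fst = distr (pmf_of_set UNIV) borel a"
    using \<pi> unfolding couplings_def by (simp cong: distr_cong)
  have snd_\<pi>: "distr \<pi> borel snd = distr (pmf_of_set UNIV) borel b"
    using \<pi> unfolding couplings_def by (simp cong: distr_cong)
  \<comment> \<open>\<open>couplings\<close> does not mention total mass; that \<open>\<pi>\<close>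
    has mass one is read off from its first marginal.\<close>
  have "prob_space (distr \<pi> borel fst)"
    unfolding fst_\<pi> by (rule measure_pmf.prob_space_distr) simp
  then have "prob_space \<pi>"
    by (rule prob_space_distrD[rotated]) measurable
  then interpret \<pi>: prob_space \<pi> .
  note [measurable] = f
  define t where "t z = (r (fst z), s (snd z))" for z
  have "t \<in> measurable (borel \<Otimes>\<^sub>M borel) (count_space UNIV \<Otimes>\<^sub>M count_space UNIV)"
    unfolding t_def by measurable
  then have t [measurable]: "t \<in> measurable (borel \<Otimes>\<^sub>M borel) (count_space UNIV)"
    by (simp add: pair_measure_count_space)
  have t' [measurable]: "t \<in> measurable \<pi> (count_space UNIV)" by measurable
  \<comment> \<open>\<open>q\<close> is the law of the chosen indices. It charges only
    representatives such as \<open>r (a k)\<close>, so its marginals need not be uniform if atoms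
    coincide.\<close>
  obtain q where q: "measure_pmf q = distr \<pi> (count_space UNIV) t"
    by (rule measure_pmf_of_finite_prob_space[of "distr \<pi> (count_space UNIV) t"])
      (auto intro: \<pi>.prob_space_distr)
  define A where "A k = pmf_of_set {j. a j = a k}" for k
  define B where "B k = pmf_of_set {j. b j = b k}" for k
  \<comment> \<open>Resampling both indices independently inside their fibres makes the marginals
    uniform and leaves the atoms, hence the value of \<open>f\<close>, unchanged.\<close>
  define p where "p = bind_pmf q (\<lambda>(k, l). pair_pmf (A k) (B l))"
  have mapq1: "map_pmf fst q = map_pmf (\<lambda>k. r (a k)) (pmf_of_set UNIV)"
  proof (rule measure_pmf_inject[THEN iffD1])
    have "measure_pmf (map_pmf fst q) = distr (distr \<pi> borel fst) (count_space UNIV) r"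
      unfolding map_pmf_rep_eq q by (simp add: distr_distr o_def t_def)
    also have "\<dots> = measure_pmf (map_pmf (\<lambda>k. r (a k)) (pmf_of_set UNIV))"
      unfolding map_pmf_rep_eq fst_\<pi> by (simp add: distr_distr o_def)
    finally show "measure_pmf (map_pmf fst q) = \<dots>" .
  qed
  have mapq2: "map_pmf snd q = map_pmf (\<lambda>k. s (b k)) (pmf_of_set UNIV)"
  proof (rule measure_pmf_inject[THEN iffD1])
    have "measure_pmf (map_pmf snd q) = distr (distr \<pi> borel snd) (count_space UNIV) s"
      unfolding map_pmf_rep_eq q by (simp add: distr_distr o_def t_def)
    also have "\<dots> = measure_pmf (map_pmf (\<lambda>k. s (b k)) (pmf_of_set UNIV))"
      unfolding map_pmf_rep_eq snd_\<pi> by (simp add: distr_distr o_def)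
    finally show "measure_pmf (map_pmf snd q) = \<dots>" .
  qed
  have "map_pmf fst p = bind_pmf (map_pmf fst q) A"
    by (simp add: p_def map_bind_pmf case_prod_beta map_fst_pair_pmf bind_map_pmf)
  also have "\<dots> = pmf_of_set UNIV"
    unfolding mapq1 by (simp add: bind_map_pmf A_def ar bind_pmf_of_set_fibre)
  finally have p1: "map_pmf fst p = pmf_of_set UNIV" .
  have "map_pmf snd p = bind_pmf (map_pmf snd q) B"
    by (simp add: p_def map_bind_pmf case_prod_beta map_snd_pair_pmf bind_map_pmf)
  also have "\<dots> = pmf_of_set UNIV"
    unfolding mapq2 by (simp add: bind_map_pmf B_def bs bind_pmf_of_set_fibre)
  finally have p2: "map_pmf snd p = pmf_of_set UNIV" .
  have [measurable]: "{x. a (r x) = x} \<in> sets borel" "{x. b (s x) = x} \<in> sets borel"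
  proof -
    have "{x. a (r x) = x} \<subseteq> range a" "{x. b (s x) = x} \<subseteq> range b"
      by (metis (mono_tags, lifting) mem_Collect_eq rangeI subsetI)+
    then have "finite {x. a (r x) = x}" "finite {x. b (s x) = x}"
      by (auto intro: finite_subset)
    then show "{x. a (r x) = x} \<in> sets borel" "{x. b (s x) = x} \<in> sets borel"
      by (auto intro: borel_closed finite_imp_closed)
  qed
  \<comment> \<open>The identity \<open>a (r x) = x\<close> may fail off the range of
    \<open>a\<close>, but the first marginal is carried by that range.\<close>
  have "AE x in distr \<pi> borel fst. a (r x) = x"
    unfolding fst_\<pi> by (subst AE_distr_iff) (auto simp: ar)
  then have AE1: "AE z in \<pi>. a (r (fst z)) = fst z"
    by (subst (asm) AE_distr_iff) auto
  have "AE x in distr \<pi> borel snd. b (s x) = x"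
    unfolding snd_\<pi> by (subst AE_distr_iff) (auto simp: bs)
  then have AE2: "AE z in \<pi>. b (s (snd z)) = snd z"
    by (subst (asm) AE_distr_iff) auto
  have "(\<integral>\<^sup>+ z. f (a (fst z), b (snd z)) \<partial>p)
      = (\<integral>\<^sup>+ z. \<integral>\<^sup>+ w. f (a (fst w), b (snd w)) \<partial>pair_pmf (A (fst z)) (B (snd z)) \<partial>q)"
    by (simp add: p_def case_prod_beta)
  also have "\<dots> = (\<integral>\<^sup>+ z. f (a (fst z), b (snd z)) \<partial>q)"
  proof (rule nn_integral_cong)
    fix z :: "'n \<times> 'm"
    have ne: "{j. a j = a k} \<noteq> {}" "{j. b j = b l} \<noteq> {}" for k l by auto
    have "(\<integral>\<^sup>+ w. f (a (fst w), b (snd w)) \<partial>pair_pmf (A (fst z)) (B (snd z)))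
        = (\<integral>\<^sup>+ w. f (a (fst z), b (snd z)) \<partial>pair_pmf (A (fst z)) (B (snd z)))"
      by (rule nn_integral_cong_AE) (auto simp: AE_measure_pmf_iff A_def B_def set_pmf_of_set[OF ne(1)] set_pmf_of_set[OF ne(2)])
    then show "(\<integral>\<^sup>+ w. f (a (fst w), b (snd w)) \<partial>pair_pmf (A (fst z)) (B (snd z)))
        = f (a (fst z), b (snd z))" by simp
  qed
  also have "\<dots> = (\<integral>\<^sup>+ z. f (a (r (fst z)), b (s (snd z))) \<partial>\<pi>)"
    unfolding q by (subst nn_integral_distr) (auto simp: t_def)
  also have "\<dots> = (\<integral>\<^sup>+ z. f z \<partial>\<pi>)"
    by (rule nn_integral_cong_AE) (use AE1 AE2 in eventually_elim, simp)
  finally have "(\<integral>\<^sup>+ z. f z \<partial>\<pi>) = (\<integral>\<^sup>+ z. f (a (fst z), b (snd z)) \<partial>p)" ..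
  then show thesis
    using p1 p2 by (intro that[of p]) (simp_all add: uniform_couplings_def)
qed

text \<open>The coupling is the image of \<open>p\<close> under the map sending a pair of indices to
  the corresponding pair of atoms.\<close>

lemma uniform_coupling_imp_coupling:
  fixes a :: "'n::finite \<Rightarrow> 'a::polish_space" and b :: "'m::finite \<Rightarrow> 'a"
  assumes p: "p \<in> uniform_couplings"
    and f: "f \<in> borel_measurable (borel \<Otimes>\<^sub>M borel)"
  obtains \<pi> where "\<pi> \<in> couplings (distr (pmf_of_set UNIV) borel a) (distr (pmf_of_set UNIV) borel b)"
    and "(\<integral>\<^sup>+ z. f z \<partial>\<pi>) = (\<integral>\<^sup>+ z. f (a (fst z), b (snd z)) \<partial>p)"
proof -
  define h where "h z = (a (fst z), b (snd z))" for z
  have h [measurable]: "h \<in> measurable (measure_pmf p) (borel \<Otimes>\<^sub>M borel)"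
    by (simp add: space_pair_measure)
  note [measurable] = f
  define \<pi> where "\<pi> = distr (measure_pmf p) (borel \<Otimes>\<^sub>M borel) h"
  have sets_\<pi> [measurable_cong]: "sets \<pi> = sets (borel \<Otimes>\<^sub>M borel)" by (simp add: \<pi>_def)
  have p': "map_pmf fst p = pmf_of_set UNIV" "map_pmf snd p = pmf_of_set UNIV"
    using p by (auto simp: uniform_couplings_def)
  have "distr \<pi> borel fst = distr (map_pmf fst p) borel a"
    unfolding \<pi>_def map_pmf_rep_eq by (subst (1 2) distr_distr) (auto simp: o_def h_def space_pair_measure)
  moreover have "distr \<pi> borel snd = distr (map_pmf snd p) borel b"
    unfolding \<pi>_def map_pmf_rep_eq by (subst (1 2) distr_distr) (auto simp: o_def h_def space_pair_measure)
  ultimately have "\<pi> \<in> couplings (distr (pmf_of_set UNIV) borel a) (distr (pmf_of_set UNIV) borel b)"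
    unfolding couplings_def p'
    by (simp add: sets_\<pi> sets_pair_measure_cong[OF sets_distr sets_distr] cong: distr_cong)
  moreover have "(\<integral>\<^sup>+ z. f z \<partial>\<pi>) = (\<integral>\<^sup>+ z. f (a (fst z), b (snd z)) \<partial>p)"
    unfolding \<pi>_def by (subst nn_integral_distr) (auto simp: h_def space_pair_measure)
  ultimately show thesis by (rule that)
qed

text \<open>Passes from the extended infimum in \<open>wasserstein2\<close> to a real one, to which
  linear estimates apply. Nonemptiness keeps the extended infimum finite.\<close>

lemma enn2real_INF_ennreal:
  fixes c :: "'i \<Rightarrow> real"
  assumes "S \<noteq> {}" and c: "\<And>i. i \<in> S \<Longrightarrow> 0 \<le> c i"
  shows "enn2real (INF i\<in>S. ennreal (c i)) = (INF i\<in>S. c i)"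
proof -
  have bdd: "bdd_below (c ` S)" using c by (intro bdd_belowI2[of _ 0])
  have nn: "0 \<le> (INF i\<in>S. c i)" using assms by (intro cINF_greatest)
  have "(INF i\<in>S. ennreal (c i)) = ennreal (INF i\<in>S. c i)"
  proof (rule antisym)
    show "(INF i\<in>S. ennreal (c i)) \<le> ennreal (INF i\<in>S. c i)"
    proof (rule ennreal_le_epsilon)
      fix e :: real assume "0 < e"
      then obtain i where i: "i \<in> S" "c i < (INF i\<in>S. c i) + e"
        using cINF_less_iff[OF assms(1) bdd, of "(INF i\<in>S. c i) + e"] by auto
      then have "(INF i\<in>S. ennreal (c i)) \<le> ennreal ((INF i\<in>S. c i) + e)"
        by (intro INF_lower2[OF i(1)] ennreal_leI) simp
      then show "(INF i\<in>S. ennreal (c i)) \<le> ennreal (INF i\<in>S. c i) + ennreal e"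
        using nn \<open>0 < e\<close> by simp
    qed
    show "ennreal (INF i\<in>S. c i) \<le> (INF i\<in>S. ennreal (c i))"
      by (intro INF_greatest ennreal_leI cINF_lower bdd)
  qed
  then show ?thesis using nn by simp
qed

lemma wasserstein2_squared_uniform:
  fixes a :: "'n::finite \<Rightarrow> 'a::polish_space" and b :: "'m::finite \<Rightarrow> 'a"
  shows "(wasserstein2 (distr (pmf_of_set UNIV) borel a) (distr (pmf_of_set UNIV) borel b))\<^sup>2
    = (INF p\<in>uniform_couplings.
        measure_pmf.expectation p (\<lambda>z. (dist (a (fst z)) (b (snd z)))\<^sup>2))"
    (is "(wasserstein2 ?\<mu> ?\<nu>)\<^sup>2 = (INF p\<in>_. ?c p)")
proof -
  let ?d = "\<lambda>z :: 'a \<times> 'a. ennreal ((dist (fst z) (snd z))\<^sup>2)"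
  have d: "?d \<in> borel_measurable (borel \<Otimes>\<^sub>M borel)" by measurable
  have c: "(\<integral>\<^sup>+ z. ?d (a (fst z), b (snd z)) \<partial>measure_pmf p) = ennreal (?c p)" for p
    by (subst nn_integral_eq_integral) (auto intro: integrable_measure_pmf_finite)
  \<comment> \<open>Only the sets of attained costs are compared: coinciding atoms can make
    different index couplings induce the same coupling, so no bijection is sought.\<close>
  have "(\<lambda>\<pi>. \<integral>\<^sup>+ z. ?d z \<partial>\<pi>) ` couplings ?\<mu> ?\<nu> = (\<lambda>p. ennreal (?c p)) ` uniform_couplings"
  proof (intro subset_antisym image_subsetI)
    fix \<pi> assume "\<pi> \<in> couplings ?\<mu> ?\<nu>"
    from coupling_imp_uniform_coupling[OF this d] obtain p where
      p: "p \<in> uniform_couplings" "(\<integral>\<^sup>+ z. ?d z \<partial>\<pi>) = (\<integral>\<^sup>+ z. ?d (a (fst z), b (snd z)) \<partial>measure_pmf p)" .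
    show "(\<integral>\<^sup>+ z. ?d z \<partial>\<pi>) \<in> (\<lambda>p. ennreal (?c p)) ` uniform_couplings"
      using p unfolding c by (rule_tac image_eqI)
  next
    fix p :: "('n \<times> 'm) pmf" assume "p \<in> uniform_couplings"
    from uniform_coupling_imp_coupling[OF this d, of a b] obtain \<pi> where
      p: "\<pi> \<in> couplings ?\<mu> ?\<nu>" "(\<integral>\<^sup>+ z. ?d z \<partial>\<pi>) = (\<integral>\<^sup>+ z. ?d (a (fst z), b (snd z)) \<partial>measure_pmf p)" .
    show "ennreal (?c p) \<in> (\<lambda>\<pi>. \<integral>\<^sup>+ z. ?d z \<partial>\<pi>) ` couplings ?\<mu> ?\<nu>"
      using p unfolding c by (rule_tac image_eqI[OF sym])
  qed
  then have "(wasserstein2 ?\<mu> ?\<nu>)\<^sup>2 = (sqrt (enn2real (INF p\<in>uniform_couplings. ennreal (?c p))))\<^sup>2"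
    unfolding wasserstein2_def by simp
  also have "\<dots> = enn2real (INF p\<in>uniform_couplings. ennreal (?c p))"
    by simp
  also have "\<dots> = (INF p\<in>uniform_couplings. ?c p)"
    by (rule enn2real_INF_ennreal[OF uniform_couplings_nonempty]) simp
  finally show ?thesis .
qed

text \<open>The empirical measure is the law of a uniformly chosen row, so that projecting it
  amounts to composing maps on the index set.\<close>

lemma empirical_measure_eq_distr:
  "empirical_measure Y = distr (pmf_of_set UNIV) borel (\<lambda>k. Y $ k)"
proof (rule measure_eqI)
  fix A assume "A \<in> sets (empirical_measure Y)"
  then have A: "A \<in> sets borel" by simp
  have "emeasure (distr (pmf_of_set UNIV) borel (\<lambda>k. Y $ k)) A
      = (\<integral>\<^sup>+ k. indicator A (Y $ k) \<partial>pmf_of_set UNIV)"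
    using A by (simp add: nn_integral_distr flip: nn_integral_indicator)
  also have "\<dots> = (\<Sum>k\<in>UNIV. indicator A (Y $ k)) / of_nat CARD('b)"
    by (simp add: nn_integral_pmf_of_set)
  also have "\<dots> = emeasure (empirical_measure Y) A"
    using A by (simp add: emeasure_empirical_measure divide_ennreal_def inverse_ennreal
      ennreal_of_nat_eq_real_of_nat mult.commute inverse_eq_divide)
  finally show "emeasure (empirical_measure Y) A = emeasure (distr (pmf_of_set UNIV) borel (\<lambda>k. Y $ k)) A" ..
qed simp

text \<open>Projection moves the atoms but not their indices. All dependence on
  \<open>\<theta>\<close> and \<open>Y\<close> thus sits in the integrand, while the set of
  competitors stays fixed.\<close>

lemma w_dir_eq_INF:
  fixes Y Z :: "real ^ 'd ^ 'n"
  shows "w_dir Z \<theta> Y = (INF p\<in>uniform_couplings.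
    measure_pmf.expectation p (\<lambda>z. (\<theta> \<bullet> (Y $ fst z - Z $ snd z))\<^sup>2))"
proof -
  have [measurable]: "proj_dir \<theta> \<in> borel_measurable borel"
    unfolding proj_dir_def[abs_def] by measurable
  show ?thesis
    unfolding w_dir_def empirical_measure_eq_distr
    by (simp add: distr_distr o_def wasserstein2_squared_uniform proj_dir_def dist_real_def inner_diff_right)
qed

section \<open>Lipschitz bounds\<close>

text \<open>This is where the common index set pays off: a bound on costs that is uniform over
  competitors passes to the infima.\<close>

lemma abs_cINF_diff_le:
  fixes c c' :: "'i \<Rightarrow> real"
  assumes "S \<noteq> {}" "bdd_below (c ` S)" "bdd_below (c' ` S)"
    and le: "\<And>i. i \<in> S \<Longrightarrow> \<bar>c i - c' i\<bar> \<le> e"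
  shows "\<bar>(INF i\<in>S. c i) - (INF i\<in>S. c' i)\<bar> \<le> e"
proof -
  have "(INF i\<in>S. c i) - e \<le> (INF i\<in>S. c' i)"
  proof (rule cINF_greatest[OF assms(1)])
    fix i assume "i \<in> S"
    with cINF_lower[OF assms(2) this] le[OF this] show "(INF i\<in>S. c i) - e \<le> c' i" by linarith
  qed
  moreover have "(INF i\<in>S. c' i) - e \<le> (INF i\<in>S. c i)"
  proof (rule cINF_greatest[OF assms(1)])
    fix i assume "i \<in> S"
    with cINF_lower[OF assms(3) this] le[OF this] show "(INF i\<in>S. c' i) - e \<le> c i" by linarith
  qed
  ultimately show ?thesis by linarith
qed

lemma bdd_below_transport_cost:
  "bdd_below ((\<lambda>p. measure_pmf.expectation p (\<lambda>z. (f z)\<^sup>2 :: real)) ` S)"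
  by (intro bdd_belowI2[of _ 0]) simp

lemma w_dir_nonneg: "0 \<le> w_dir Z \<theta> Y"
  by (simp add: w_dir_def)

lemma abs_inner_row_diff_le:
  fixes Y Z :: "real ^ 'd ^ 'n"
  assumes "norm \<theta> \<le> 1" "norm Y \<le> R"
  shows "\<bar>\<theta> \<bullet> (Y $ k - Z $ l)\<bar> \<le> R + norm Z"
proof -
  have "\<bar>\<theta> \<bullet> (Y $ k - Z $ l)\<bar> \<le> norm \<theta> * norm (Y $ k - Z $ l)"
    by (rule Cauchy_Schwarz_ineq2)
  also have "\<dots> \<le> norm (Y $ k - Z $ l)"
    using mult_right_mono[OF assms(1), of "norm (Y $ k - Z $ l)"] by simp
  also have "\<dots> \<le> norm (Y $ k) + norm (Z $ l)"
    by (rule norm_triangle_ineq4)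
  also have "\<dots> \<le> R + norm Z"
    using Finite_Cartesian_Product.norm_nth_le[of Y k] Finite_Cartesian_Product.norm_nth_le[of Z l] assms(2)
    by linarith
  finally show ?thesis .
qed

text \<open>Any single competitor bounds the infimum from above, and its integrand is bounded
  pointwise.\<close>

lemma w_dir_le:
  assumes "norm \<theta> \<le> 1" "norm Y \<le> R"
  shows "w_dir Z \<theta> Y \<le> (R + norm Z)\<^sup>2"
proof -
  let ?c = "\<lambda>p. measure_pmf.expectation p (\<lambda>z. (\<theta> \<bullet> (Y $ fst z - Z $ snd z))\<^sup>2)"
  obtain p :: "('b \<times> 'b) pmf" where p: "p \<in> uniform_couplings"
    using uniform_couplings_nonempty by blast
  have "(\<theta> \<bullet> (Y $ k - Z $ l))\<^sup>2 \<le> (R + norm Z)\<^sup>2" for k l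
    using power_mono[OF abs_inner_row_diff_le[OF assms, of k Z l], of 2] by simp
  then have "?c p \<le> measure_pmf.expectation p (\<lambda>_. (R + norm Z)\<^sup>2)"
    by (intro integral_mono integrable_measure_pmf_finite) auto
  moreover have "w_dir Z \<theta> Y \<le> ?c p"
    unfolding w_dir_eq_INF using p by (intro cINF_lower bdd_below_transport_cost)
  ultimately show ?thesis by simp
qed

text \<open>For each pair of indices the difference of squares factors into a sum, at most
  \<open>2 * (R + norm Z)\<close> in absolute value, and a difference controlled by the changes of
  \<open>Y\<close> and \<open>\<theta>\<close>.\<close>

lemma w_dir_diff_le:
  fixes Y Y' Z :: "real ^ 'd ^ 'n"
  assumes \<theta>: "norm \<theta> \<le> 1" "norm \<theta>' \<le> 1" and Y: "norm Y \<le> R" "norm Y' \<le> R"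
  shows "\<bar>w_dir Z \<theta> Y - w_dir Z \<theta>' Y'\<bar>
    \<le> 2 * (R + norm Z) * (norm (Y - Y') + (R + norm Z) * norm (\<theta> - \<theta>'))" (is "_ \<le> ?e")
  unfolding w_dir_eq_INF
proof (rule abs_cINF_diff_le[OF uniform_couplings_nonempty bdd_below_transport_cost bdd_below_transport_cost])
  fix p :: "('n \<times> 'n) pmf"
  let ?B = "R + norm Z"
  have le: "\<bar>(\<theta> \<bullet> (Y $ k - Z $ l))\<^sup>2 - (\<theta>' \<bullet> (Y' $ k - Z $ l))\<^sup>2\<bar> \<le> ?e" for k l
  proof -
    define u where "u = \<theta> \<bullet> (Y $ k - Z $ l)"
    define v where "v = \<theta>' \<bullet> (Y' $ k - Z $ l)"
    have uv: "\<bar>u\<bar> \<le> ?B" "\<bar>v\<bar> \<le> ?B"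
      unfolding u_def v_def using \<theta> Y by (auto intro: abs_inner_row_diff_le)
    have B: "0 \<le> ?B" using uv by linarith
    \<comment> \<open>The matrix is changed first with \<open>\<theta>\<close> kept, then the
      direction with \<open>Y'\<close> kept.\<close>
    have "u - v = \<theta> \<bullet> ((Y - Y') $ k) + (\<theta> - \<theta>') \<bullet> (Y' $ k - Z $ l)"
      by (simp add: u_def v_def inner_diff_left inner_diff_right)
    moreover have "\<bar>\<theta> \<bullet> ((Y - Y') $ k)\<bar> \<le> norm (Y - Y')"
    proof -
      have "\<bar>\<theta> \<bullet> ((Y - Y') $ k)\<bar> \<le> norm \<theta> * norm ((Y - Y') $ k)"
        by (rule Cauchy_Schwarz_ineq2)
      also have "\<dots> \<le> 1 * norm (Y - Y')"
        using \<theta>(1) by (intro mult_mono Finite_Cartesian_Product.norm_nth_le) auto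
      finally show ?thesis by simp
    qed
    moreover have "\<bar>(\<theta> - \<theta>') \<bullet> (Y' $ k - Z $ l)\<bar> \<le> ?B * norm (\<theta> - \<theta>')"
    proof -
      have "norm (Y' $ k - Z $ l) \<le> norm (Y' $ k) + norm (Z $ l)"
        by (rule norm_triangle_ineq4)
      also have "\<dots> \<le> ?B"
        using Finite_Cartesian_Product.norm_nth_le[of Y' k]
          Finite_Cartesian_Product.norm_nth_le[of Z l] Y(2) by linarith
      finally show ?thesis
        using Cauchy_Schwarz_ineq2[of "\<theta> - \<theta>'" "Y' $ k - Z $ l"]
          mult_left_mono[of "norm (Y' $ k - Z $ l)" ?B "norm (\<theta> - \<theta>')"]
        by (simp add: mult.commute)
    qed
    ultimately have d: "\<bar>u - v\<bar> \<le> norm (Y - Y') + ?B * norm (\<theta> - \<theta>')" by linarith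
    have "\<bar>u\<^sup>2 - v\<^sup>2\<bar> = \<bar>u + v\<bar> * \<bar>u - v\<bar>"
      by (simp add: power2_eq_square square_diff_square_factored abs_mult)
    also have "\<dots> \<le> (2 * ?B) * (norm (Y - Y') + ?B * norm (\<theta> - \<theta>'))"
      using uv B d by (intro mult_mono) auto
    finally show ?thesis by (simp add: u_def v_def)
  qed
  have "\<bar>measure_pmf.expectation p (\<lambda>z. (\<theta> \<bullet> (Y $ fst z - Z $ snd z))\<^sup>2)
      - measure_pmf.expectation p (\<lambda>z. (\<theta>' \<bullet> (Y' $ fst z - Z $ snd z))\<^sup>2)\<bar>
    = \<bar>measure_pmf.expectation p (\<lambda>z. (\<theta> \<bullet> (Y $ fst z - Z $ snd z))\<^sup>2 - (\<theta>' \<bullet> (Y' $ fst z - Z $ snd z))\<^sup>2)\<bar>"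
    by (subst Bochner_Integration.integral_diff) (auto intro: integrable_measure_pmf_finite)
  also have "\<dots> \<le> measure_pmf.expectation p (\<lambda>z. \<bar>(\<theta> \<bullet> (Y $ fst z - Z $ snd z))\<^sup>2 - (\<theta>' \<bullet> (Y' $ fst z - Z $ snd z))\<^sup>2\<bar>)"
    by (rule integral_abs_bound)
  also have "\<dots> \<le> measure_pmf.expectation p (\<lambda>_. ?e)"
    using le by (intro integral_mono integrable_measure_pmf_finite) auto
  also have "\<dots> = ?e" by simp
  finally show "\<bar>measure_pmf.expectation p (\<lambda>z. (\<theta> \<bullet> (Y $ fst z - Z $ snd z))\<^sup>2)
      - measure_pmf.expectation p (\<lambda>z. (\<theta>' \<bullet> (Y' $ fst z - Z $ snd z))\<^sup>2)\<bar> \<le> ?e" .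
qed

text \<open>Lipschitz continuity in the direction on the sphere gives Borel measurability there; the
  constant is the case \<open>Y' = Y\<close>, \<open>R = norm Y\<close> of
  \<open>w_dir_diff_le\<close>.\<close>

lemma w_dir_measurable [measurable]: "(\<lambda>\<theta>. w_dir Z \<theta> Y) \<in> borel_measurable uniform_sphere"
proof -
  let ?C = "2 * (norm Y + norm Z)\<^sup>2"
  have "?C-lipschitz_on (sphere 0 1) (\<lambda>\<theta>. w_dir Z \<theta> Y)"
  proof (rule lipschitz_onI)
    fix \<theta> \<theta>' :: "real ^ 'a" assume "\<theta> \<in> sphere 0 1" "\<theta>' \<in> sphere 0 1"
    then show "dist (w_dir Z \<theta> Y) (w_dir Z \<theta>' Y) \<le> ?C * dist \<theta> \<theta>'"
      using w_dir_diff_le[of \<theta> \<theta>' Y "norm Y" Y Z]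
      by (simp add: dist_real_def dist_norm power2_eq_square algebra_simps)
  qed simp
  then have "(\<lambda>\<theta>. w_dir Z \<theta> Y) \<in> borel_measurable (restrict_space borel (sphere 0 1))"
    by (intro borel_measurable_continuous_on_restrict lipschitz_on_continuous_on)
  then show ?thesis
    by (simp add: measurable_cong_sets[OF sets_uniform_sphere refl])
qed

lemma w_dir_integrable: "integrable uniform_sphere (\<lambda>\<theta>. w_dir Z \<theta> Y)"
proof -
  interpret prob_space "uniform_sphere :: (real ^ 'a) measure" by (rule prob_space_uniform_sphere)
  show ?thesis
    by (rule integrable_const_bound[of _ "(norm Y + norm Z)\<^sup>2"])
      (auto intro!: AE_I2 w_dir_le simp: w_dir_nonneg)
qed

text \<open>The constant is free of \<open>\<theta>\<close>, so it survives averaging over the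
  sphere and over any finite sample of directions.\<close>

lemma w_dir_lipschitz:
  assumes "norm \<theta> \<le> 1" "0 \<le> R"
  shows "(2 * (R + norm Z))-lipschitz_on (cball 0 R) (w_dir Z \<theta>)"
proof (rule lipschitz_onI)
  fix Y Y' :: "real ^ 'a ^ 'b" assume "Y \<in> cball 0 R" "Y' \<in> cball 0 R"
  then show "dist (w_dir Z \<theta> Y) (w_dir Z \<theta> Y') \<le> 2 * (R + norm Z) * dist Y Y'"
    using w_dir_diff_le[OF assms(1) assms(1), of Y R Y' Z] by (simp add: dist_real_def dist_norm)
qed (use assms in simp)

lemma energy_lipschitz:
  assumes "0 \<le> R"
  shows "(2 * (R + norm Z))-lipschitz_on (cball 0 R) (energy Z)"
proof (rule lipschitz_onI)
  fix Y Y' :: "real ^ 'a ^ 'b" assume Y: "Y \<in> cball 0 R" "Y' \<in> cball 0 R"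
  interpret prob_space "uniform_sphere :: (real ^ 'a) measure" by (rule prob_space_uniform_sphere)
  have "\<bar>energy Z Y - energy Z Y'\<bar> = \<bar>\<integral>\<theta>. w_dir Z \<theta> Y - w_dir Z \<theta> Y' \<partial>uniform_sphere\<bar>"
    unfolding energy_def by (subst Bochner_Integration.integral_diff) (auto simp: w_dir_integrable)
  also have "\<dots> \<le> (\<integral>\<theta>. \<bar>w_dir Z \<theta> Y - w_dir Z \<theta> Y'\<bar> \<partial>uniform_sphere)"
    by (rule integral_abs_bound)
  also have "\<dots> \<le> (\<integral>\<theta>. 2 * (R + norm Z) * dist Y Y' \<partial>(uniform_sphere :: (real ^ 'a) measure))"
  proof (rule integral_mono)
    fix \<theta> :: "real ^ 'a" assume "\<theta> \<in> space uniform_sphere"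
    then have "norm \<theta> \<le> 1" by simp
    from lipschitz_onD[OF w_dir_lipschitz[OF this assms] Y]
    show "\<bar>w_dir Z \<theta> Y - w_dir Z \<theta> Y'\<bar> \<le> 2 * (R + norm Z) * dist Y Y'"
      by (simp add: dist_real_def)
  qed (auto simp: w_dir_integrable)
  also have "\<dots> = 2 * (R + norm Z) * dist Y Y'"
    using prob_space by simp
  finally show "dist (energy Z Y) (energy Z Y') \<le> 2 * (R + norm Z) * dist Y Y'"
    by (simp add: dist_real_def)
qed (use assms in simp)

lemma energy_mc_lipschitz:
  assumes "0 \<le> R" and "\<And>i. i \<ge> 1 \<Longrightarrow> norm (\<theta> i) \<le> 1"
  shows "(2 * (R + norm Z))-lipschitz_on (cball 0 R) (energy_mc Z \<theta> p)"
proof (rule lipschitz_onI)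
  fix Y Y' :: "real ^ 'a ^ 'b" assume Y: "Y \<in> cball 0 R" "Y' \<in> cball 0 R"
  have "\<bar>\<Sum>i=1..p. w_dir Z (\<theta> i) Y - w_dir Z (\<theta> i) Y'\<bar>
      \<le> (\<Sum>i=1..p. \<bar>w_dir Z (\<theta> i) Y - w_dir Z (\<theta> i) Y'\<bar>)"
    by (rule sum_abs)
  also have "\<dots> \<le> (\<Sum>i=1..p. 2 * (R + norm Z) * dist Y Y')"
    using lipschitz_onD[OF w_dir_lipschitz[OF assms(2) assms(1)] Y]
    by (intro sum_mono) (simp add: dist_real_def)
  finally have le: "\<bar>\<Sum>i=1..p. w_dir Z (\<theta> i) Y - w_dir Z (\<theta> i) Y'\<bar>
    \<le> real p * (2 * (R + norm Z) * dist Y Y')" by simp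
  have "energy_mc Z \<theta> p Y - energy_mc Z \<theta> p Y'
      = (\<Sum>i=1..p. w_dir Z (\<theta> i) Y - w_dir Z (\<theta> i) Y') / real p"
    by (simp add: energy_mc_def sum_subtractf diff_divide_distrib)
  \<comment> \<open>For \<open>p = 0\<close> division by zero makes \<open>energy_mc\<close> vanish
    identically, so the bound holds there as well.\<close>
  with le have "\<bar>energy_mc Z \<theta> p Y - energy_mc Z \<theta> p Y'\<bar> \<le> 2 * (R + norm Z) * dist Y Y'"
    using assms(1) by (cases "p = 0") (auto simp: abs_divide divide_le_eq mult.commute)
  then show "dist (energy_mc Z \<theta> p Y) (energy_mc Z \<theta> p Y') \<le> 2 * (R + norm Z) * dist Y Y'"
    by (simp add: dist_real_def)
qed (use assms in simp)

section \<open>A strong law for bounded variables\<close>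

text \<open>Hoeffding's bound decays geometrically in the sample size, so Borel-Cantelli applies to
  each fixed tolerance; countably many tolerances then give convergence.\<close>

lemma (in prob_space) bounded_iid_strong_law:
  fixes X :: "nat \<Rightarrow> 'a \<Rightarrow> real"
  assumes indep: "indep_vars (\<lambda>_. borel) X {1..}"
    and ident: "\<And>i. i \<ge> 1 \<Longrightarrow> distr M borel (X i) = distr M borel (X 1)"
    and bound: "AE \<omega> in M. X 1 \<omega> \<in> {a..b}"
  shows "AE \<omega> in M. (\<lambda>p. (\<Sum>i=1..p. X i \<omega>) / real p) \<longlonglongrightarrow> expectation (X 1)"
proof -
  have X [measurable]: "X i \<in> borel_measurable M" if "i \<ge> 1" for i
    using indep that unfolding indep_vars_def by auto
  let ?S = "\<lambda>p \<omega>. (\<Sum>i=1..p. X i \<omega>) / real p"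
  let ?\<mu> = "expectation (X 1)"
  have ev: "AE \<omega> in M. \<forall>\<^sub>F p in sequentially. \<bar>?S p \<omega> - ?\<mu>\<bar> < e" if "0 < e" for e
  proof -
    \<comment> \<open>Enlarging \<open>b\<close> makes the interval nondegenerate, since Hoeffding's
      exponent divides by its squared length.\<close>
    define c where "c = max b (a + 1)"
    \<comment> \<open>The shift to \<open>Suc p\<close> keeps the sample nonempty; it is undone by
      \<open>eventually_sequentially_Suc\<close>.\<close>
    define A where "A p = {\<omega> \<in> space M. \<bar>?S (Suc p) \<omega> - ?\<mu>\<bar> \<ge> e}" for p
    define q where "q = exp (- (2 * e\<^sup>2 / (c - a)\<^sup>2))"
    have ac: "a < c" by (simp add: c_def)
    have [measurable]: "(\<lambda>\<omega>. \<Sum>i=1..p. X i \<omega>) \<in> borel_measurable M" for p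
      by (rule borel_measurable_sum) (auto intro: X)
    have "0 \<le> q" "q < 1"
      using that ac by (auto simp: q_def)
    have le: "prob (A p) \<le> 2 * q ^ Suc p" for p
    proof -
      interpret Hoeffding_ineq_iid M "{1..Suc p}" X "X 1" a c ?\<mu>
      proof unfold_locales
        show "indep_vars (\<lambda>_. borel) X {1..Suc p}"
          by (rule indep_vars_subset[OF indep]) auto
        show "AE \<omega> in M. X 1 \<omega> \<in> {a..c}"
          using bound by eventually_elim (auto simp: c_def)
        show "distr M borel (X i) = distr M borel (X 1)" if "i \<in> {1..Suc p}" for i
          using that by (intro ident) simp
      qed auto
      have card: "card {1..Suc p} = Suc p" by simp
      have "prob (A p) \<le> 2 * exp (- 2 * real (Suc p) * e\<^sup>2 / (c - a)\<^sup>2)"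
        unfolding A_def
        by (rule Hoeffding_ineq_abs_ge'[OF less_imp_le[OF that] ac, unfolded card]) simp
      \<comment> \<open>The exponent is linear in the sample size, so the bound is a power of
        \<open>q\<close> and the series is geometric.\<close>
      also have "- 2 * real (Suc p) * e\<^sup>2 / (c - a)\<^sup>2 = real (Suc p) * (- (2 * e\<^sup>2 / (c - a)\<^sup>2))"
        by (simp del: of_nat_Suc)
      also have "exp \<dots> = q ^ Suc p"
        unfolding q_def by (rule exp_of_nat_mult)
      finally show ?thesis .
    qed
    have "summable (\<lambda>p. prob (A p))"
    proof (rule summable_comparison_test'[where N = 0])
      show "summable (\<lambda>p. 2 * q ^ Suc p)"
        using summable_mult[OF summable_geometric[of q], of "2 * q"] \<open>0 \<le> q\<close> \<open>q < 1\<close>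
        by (simp add: mult.assoc)
      show "norm (prob (A p)) \<le> 2 * q ^ Suc p" for p
        using le[of p] by (simp del: power_Suc)
    qed
    moreover have "A p \<in> events" for p
      unfolding A_def by measurable
    ultimately have "AE \<omega> in M. \<forall>\<^sub>F p in sequentially. \<omega> \<in> space M - A p"
      by (intro borel_cantelli_AE1) (auto simp: emeasure_eq_measure)
    then show ?thesis
    proof eventually_elim
      case (elim \<omega>)
      then have "\<forall>\<^sub>F p in sequentially. \<bar>?S (Suc p) \<omega> - ?\<mu>\<bar> < e"
        by (rule eventually_mono) (simp add: A_def not_le del: sum.cl_ivl_Suc of_nat_Suc)
      then show ?case
        by (rule eventually_sequentially_Suc[THEN iffD1])
    qed
  qed
  have "AE \<omega> in M. \<forall>k. \<forall>\<^sub>F p in sequentially. \<bar>?S p \<omega> - ?\<mu>\<bar> < 1 / real (Suc k)"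
    unfolding AE_all_countable by (intro allI ev) simp
  then show ?thesis
  proof eventually_elim
    case (elim \<omega>)
    show ?case
    proof (rule tendstoI)
      fix e :: real assume "0 < e"
      then obtain k where "1 / real (Suc k) < e"
        using nat_approx_posE by blast
      with elim[rule_format, of k] show "\<forall>\<^sub>F p in sequentially. dist (?S p \<omega>) ?\<mu> < e"
        by (auto elim!: eventually_mono simp: dist_real_def)
    qed
  qed
qed

section \<open>Uniform convergence on compact sets\<close>

text \<open>Each value of \<open>f\<close> on \<open>K\<close> is a limit of values along a sequence
  in \<open>C\<close>, and such a limit cannot exceed the supremum over \<open>C\<close>.\<close>

lemma linf_norm_on_dense:
  fixes f :: "'a::metric_space \<Rightarrow> real"
  assumes "continuous_on K f" "C \<subseteq> K" "K \<subseteq> closure C"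
  shows "linf_norm_on K f = linf_norm_on C f"
  unfolding linf_norm_on_def
proof (rule antisym)
  show "(SUP x\<in>K. ennreal \<bar>f x\<bar>) \<le> (SUP x\<in>C. ennreal \<bar>f x\<bar>)"
  proof (rule SUP_least)
    fix x assume "x \<in> K"
    then obtain u where u: "\<And>n. u n \<in> C" "u \<longlonglongrightarrow> x"
      using assms(3) closure_sequential by blast
    then have "(\<lambda>n. f (u n)) \<longlonglongrightarrow> f x"
      using assms(1,2) \<open>x \<in> K\<close> unfolding continuous_on_sequentially o_def by blast
    then have "(\<lambda>n. ennreal \<bar>f (u n)\<bar>) \<longlonglongrightarrow> ennreal \<bar>f x\<bar>"
      by (intro tendsto_ennrealI tendsto_rabs)
    moreover have "ennreal \<bar>f (u n)\<bar> \<le> (SUP x\<in>C. ennreal \<bar>f x\<bar>)" for n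
      using u(1) by (rule SUP_upper)
    ultimately show "ennreal \<bar>f x\<bar> \<le> (SUP x\<in>C. ennreal \<bar>f x\<bar>)"
      using LIMSEQ_le_const2 by blast
  qed
qed (use assms(2) in \<open>rule SUP_subset_mono, auto\<close>)

text \<open>Compactness yields finitely many centres in \<open>C\<close>; eventually all functions
  are small there at once, and the common Lipschitz constant controls the rest of each ball.\<close>

lemma linf_norm_on_tendsto_0_equilipschitz:
  fixes g :: "nat \<Rightarrow> 'a::metric_space \<Rightarrow> real"
  assumes K: "compact K" and C: "C \<subseteq> K" "K \<subseteq> closure C"
    and lip: "\<And>p. L-lipschitz_on K (g p)"
    and lim: "\<And>x. x \<in> C \<Longrightarrow> (\<lambda>p. g p x) \<longlonglongrightarrow> 0"
  shows "(\<lambda>p. linf_norm_on K (g p)) \<longlonglongrightarrow> 0"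
proof (rule tendsto_0_if_Limsup_eq_0_ennreal)
  have L: "0 \<le> L" using lip by (rule lipschitz_on_nonneg)
  have "limsup (\<lambda>p. linf_norm_on K (g p)) \<le> 0"
  proof (rule ennreal_le_epsilon)
    fix e :: real assume e: "0 < e"
    \<comment> \<open>The radius makes the variation inside a ball at most \<open>e / 2\<close>; the
      summand 1 keeps the denominator positive when \<open>L = 0\<close>.\<close>
    define d where "d = e / (2 * (L + 1))"
    have d: "0 < d" "L * d \<le> e / 2"
      using e L by (auto simp: d_def field_simps)
    have "K \<subseteq> (\<Union>c\<in>C. ball c d)"
    proof
      fix x assume "x \<in> K"
      then obtain c where "c \<in> C" "dist c x < d"
        using C(2) d(1) closure_approachable[of x C] by auto
      then show "x \<in> (\<Union>c\<in>C. ball c d)" by auto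
    qed
    then obtain F where F: "F \<subseteq> C" "finite F" "K \<subseteq> (\<Union>c\<in>F. ball c d)"
      using compactE_image[OF K, of C "\<lambda>c. ball c d"] by auto
    have "\<forall>\<^sub>F p in sequentially. \<forall>c\<in>F. \<bar>g p c\<bar> < e / 2"
    proof (rule eventually_ball_finite[OF F(2)], rule ballI)
      fix c assume "c \<in> F"
      then have "(\<lambda>p. g p c) \<longlonglongrightarrow> 0" using F(1) lim by blast
      from tendstoD[OF this, of "e / 2"] e show "\<forall>\<^sub>F p in sequentially. \<bar>g p c\<bar> < e / 2"
        by simp
    qed
    then have "\<forall>\<^sub>F p in sequentially. linf_norm_on K (g p) \<le> ennreal e"
    proof eventually_elim
      case (elim p)
      show ?case unfolding linf_norm_on_def
      proof (intro SUP_least ennreal_leI)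
        fix x assume x: "x \<in> K"
        then obtain c where c: "c \<in> F" "dist c x < d" using F(3) by auto
        have "\<bar>g p x - g p c\<bar> \<le> L * dist x c"
          using lipschitz_onD[OF lip x, of c] c F(1) C(1) by (auto simp: dist_real_def)
        also have "\<dots> \<le> L * d"
          using c(2) L by (intro mult_left_mono) (auto simp: dist_commute)
        finally show "\<bar>g p x\<bar> \<le> e"
          using elim c(1) d(2) by fastforce
      qed
    qed
    then show "limsup (\<lambda>p. linf_norm_on K (g p)) \<le> 0 + ennreal e"
      by (simp add: Limsup_bounded)
  qed
  then show "limsup (\<lambda>p. linf_norm_on K (g p)) = 0" by simp
qed

text \<open>As values are nonnegative, a vanishing limsup forces convergence. This expresses the
  convergence event through a measurable function.\<close>

lemma ennreal_tendsto_0_iff_limsup: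
  fixes f :: "nat \<Rightarrow> ennreal"
  shows "f \<longlonglongrightarrow> 0 \<longleftrightarrow> limsup f = 0"
  using lim_imp_Limsup[of sequentially f 0] tendsto_0_if_Limsup_eq_0_ennreal[of sequentially f] by auto

theorem theorem2p3:
  fixes M :: "'w measure"
    and \<theta> :: "nat \<Rightarrow> 'w \<Rightarrow> real ^ 'd"
    and Z :: "real ^ 'd ^ 'n"
    and K :: "(real ^ 'd ^ 'n) set"
  assumes "prob_space M"
    and "prob_space.indep_vars M (\<lambda>_. uniform_sphere) \<theta> {1..}"
    and "\<And>i. i \<ge> 1 \<Longrightarrow> distr M uniform_sphere (\<theta> i) = uniform_sphere"
    and "compact K"
  shows "\<P>(\<omega> in M. (\<lambda>p. linf_norm_on K
           (\<lambda>Y. energy_mc Z (\<lambda>i. \<theta> i \<omega>) p Y - energy Z Y)) \<longlonglongrightarrow> 0) = 1"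
proof -
  interpret prob_space M by fact
  have \<theta> [measurable]: "\<theta> i \<in> measurable M uniform_sphere" if "i \<ge> 1" for i
    using assms(2) that unfolding indep_vars_def by auto
  \<comment> \<open>The underlying space of \<open>uniform_sphere\<close> is the sphere, so the
    bound holds for every outcome and not just almost surely.\<close>
  have norm_\<theta>: "norm (\<theta> i \<omega>) \<le> 1" if "\<omega> \<in> space M" "i \<ge> 1" for i \<omega>
    using measurable_space[OF \<theta>[OF that(2)] that(1)] by simp
  obtain R where R: "0 < R" "\<And>Y. Y \<in> K \<Longrightarrow> norm Y \<le> R"
    using compact_imp_bounded[OF assms(4)] unfolding bounded_pos by blast
  define L where "L = 2 * (R + norm Z)"
  obtain C where C: "countable C" "C \<subseteq> K" "K \<subseteq> closure C"
    by (rule separable)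
  define g where "g \<omega> p Y = energy_mc Z (\<lambda>i. \<theta> i \<omega>) p Y - energy Z Y" for \<omega> p Y
  \<comment> \<open>Both \<open>energy_mc\<close> and \<open>energy\<close> are
    \<open>L\<close>-Lipschitz on the ball of radius \<open>R\<close>, which contains
    \<open>K\<close>; their difference has at most the sum of the constants.\<close>
  have lip: "(L + L)-lipschitz_on K (g \<omega> p)" if "\<omega> \<in> space M" for \<omega> p
  proof (rule lipschitz_on_subset)
    show "(L + L)-lipschitz_on (cball 0 R) (g \<omega> p)"
      unfolding g_def[abs_def] L_def using R(1) norm_\<theta>[OF that]
      by (intro lipschitz_on_diff energy_mc_lipschitz energy_lipschitz) auto
  qed (use R(2) in auto)
  have w [measurable]: "(\<lambda>\<omega>. w_dir Z (\<theta> i \<omega>) Y) \<in> borel_measurable M" if "i \<ge> 1" for i Y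
    using measurable_compose[OF \<theta>[OF that] w_dir_measurable] .
  have lln: "AE \<omega> in M. (\<lambda>p. g \<omega> p Y) \<longlonglongrightarrow> 0" for Y
  proof -
    let ?X = "\<lambda>i \<omega>. w_dir Z (\<theta> i \<omega>) Y"
    have distr_X: "distr M borel (?X i) = distr uniform_sphere borel (\<lambda>\<theta>. w_dir Z \<theta> Y)" if "i \<ge> 1" for i
      using distr_distr[OF w_dir_measurable[of Z Y] \<theta>[OF that]] assms(3)[OF that] by (simp add: o_def)
    have "AE \<omega> in M. (\<lambda>p. (\<Sum>i=1..p. ?X i \<omega>) / real p) \<longlonglongrightarrow> expectation (?X 1)"
    proof (rule bounded_iid_strong_law[where a = 0 and b = "(norm Y + norm Z)\<^sup>2"])
      show "indep_vars (\<lambda>_. borel) ?X {1..}"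
        by (rule indep_vars_compose2[OF assms(2)]) measurable
      show "AE \<omega> in M. ?X 1 \<omega> \<in> {0..(norm Y + norm Z)\<^sup>2}"
        using norm_\<theta> by (intro AE_I2) (auto intro: w_dir_le simp: w_dir_nonneg)
    qed (simp add: distr_X)
    \<comment> \<open>Change of variables: \<open>\<theta> 1\<close> has law
      \<open>uniform_sphere\<close>.\<close>
    moreover have "expectation (?X 1) = energy Z Y"
      using integral_distr[OF \<theta>[of 1] w_dir_measurable[of Z Y]] assms(3)[of 1] by (simp add: energy_def)
    ultimately have "AE \<omega> in M. (\<lambda>p. (\<Sum>i=1..p. ?X i \<omega>) / real p) \<longlonglongrightarrow> energy Z Y"
      by simp
    then show ?thesis
    proof eventually_elim
      case (elim \<omega>)
      from LIM_zero[OF this] show ?case by (simp add: g_def energy_mc_def)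
    qed
  qed
  have [measurable]: "(\<lambda>\<omega>. g \<omega> p Y) \<in> borel_measurable M" for p Y
    unfolding g_def energy_mc_def
    by (intro borel_measurable_diff borel_measurable_times borel_measurable_sum) (auto intro: w)
  text \<open>The uncountable supremum is reduced to a countable one, which makes the event measurable.\<close>
  have dense: "linf_norm_on K (g \<omega> p) = linf_norm_on C (g \<omega> p)" if "\<omega> \<in> space M" for \<omega> p
    using lip[OF that] C(2,3) by (intro linf_norm_on_dense lipschitz_on_continuous_on)
  have [measurable]: "(\<lambda>\<omega>. linf_norm_on C (g \<omega> p)) \<in> borel_measurable M" for p
    unfolding linf_norm_on_def using C(1) by measurable
  have "{\<omega> \<in> space M. (\<lambda>p. linf_norm_on K (g \<omega> p)) \<longlonglongrightarrow> 0}
      = {\<omega> \<in> space M. limsup (\<lambda>p. linf_norm_on C (g \<omega> p)) = 0}"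
    by (auto simp: dense ennreal_tendsto_0_iff_limsup)
  also have "\<dots> \<in> events" by measurable
  finally have ev: "{\<omega> \<in> space M. (\<lambda>p. linf_norm_on K (g \<omega> p)) \<longlonglongrightarrow> 0} \<in> events" .
  \<comment> \<open>The exceptional null set depends on \<open>Y\<close>; countability of
    \<open>C\<close> lets these sets be merged into one.\<close>
  have "AE \<omega> in M. \<forall>Y\<in>C. (\<lambda>p. g \<omega> p Y) \<longlonglongrightarrow> 0"
    using C(1) lln by (simp add: AE_ball_countable)
  then have "AE \<omega> in M. (\<lambda>p. linf_norm_on K (g \<omega> p)) \<longlonglongrightarrow> 0"
    using AE_space
  proof eventually_elim
    case (elim \<omega>)
    then show ?case
      by (intro linf_norm_on_tendsto_0_equilipschitz[OF assms(4) C(2,3) lip]) auto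
  qed
  \<comment> \<open>Turning the almost sure statement into probability exactly one uses the
    measurability of the event, \<open>ev\<close>.\<close>
  then show ?thesis
    using prob_Collect_eq_1[OF ev] by (simp add: g_def[abs_def])
qed

end
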